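(* There are exactly 4 two-colour rosette symmetry groups that are compatible with generalized hitomezashi patterns (GHPs). They are: \begin{itemize} \item $d'1$: contains one flip-reflection; \item $c2'$: contains a center of flip-two-fold rotation symmetry; \item $d2'$: contains one line of reflection and one perpendicular line of flip-reflection that intersect at a center of flip-two-fold rotation symmetry; \item $d4'$: contains two lines of reflection and two lines of flip-reflection that form $45^\circ$ angles, intersecting at a center of flip-four-fold rotation symmetry. \end{itemize}
   Context: For a binary string $a=a_1\ldots a_n$: the reverse is $a^R=a_n\ldots a_1$, the complement is $a^C=(1-a_1)\ldots(1-a_n)$, and the reverse-complement is $a^{RC}=(1-a_n)\ldots(1-a_1)$. The GHP generated by $(x,y)$ with $x\in\{0,1\}^n$, $y\in\{0,1\}^m$ ($n,m\ge1$) is a stitched design on an $(n-1)\times(m-1)$ square grid: $x$ is read along the bottom and determines the $n$ vertical lines of stitches, $y$ is read up the left side and determines the $m$ horizontal lines of stitches. On each line, unit stitches alternate between front and back of the fabric; entry 1 (resp. 0) means the first stitch from the bottom/left is on the front (resp. back). The isometries considered are the elements of the symmetry group $D_4$ of a square: identity $e$, counterclockwise rotations $r_{90},r_{180},r_{270}$, reflections $R_H$ (across the horizontal midline), $R_V$ (across the vertical midline), $R_D$ (across the diagonal of slope $+1$), $R_A$ (across the diagonal of slope $-1$). Their effect on generating strings is: $R_H(x,y)=(x,y^R)$ if $m$ even, $(x^C,y^R)$ if $m$ odd; $R_V(x,y)=(x^R,y)$ if $n$ even, $(x^R,y^C)$ if $n$ odd; $R_D(x,y)=(y,x)$; $R_A(x,y)=(y^R,x^R)$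 if $n$ even, $(y^{RC},x^{RC})$ if $n$ odd (with $n=m$); $r_{90}(x,y)=(y^R,x)$ if $m$ even, $(y^R,x^C)$ if $m$ odd; $r_{270}(x,y)=(y,x^R)$ if $n$ even, $(y^C,x^R)$ if $n$ odd; $r_{180}(x,y)=(x^R,y^R)$ if $n,m$ even; $(x^{RC},y^R)$ if $n$ even, $m$ odd; $(x^R,y^{RC})$ if $n$ odd, $m$ even; $(x^{RC},y^{RC})$ if $n,m$ odd. The maps $R_D,R_A,r_{90},r_{270}$ can be symmetries only when $n=m$. Let $B(x,y)=(x^C,y^C)$ (exchange of front and back stitches). For $s\in D_4$ put $\overline{s}=B\circ s$ (flip-reflection or flip-rotation). A map $s$ (colour-preserving) or $\overline s$ (colour-reversing) is a symmetry of the GHP generated by $(x,y)$ if it sends $(x,y)$ to $(x,y)$. The symmetry group of the GHP is the set of all such symmetries $s$ and $\overline s$. Two-colour rosette symmetry groups (groups of symmetries fixing a point, each preserving or reversing colours, at least one reversing colours; the colour-reversing elements are the flip-symmetries): $cn'$ ($n$ even) consists of $n$ rotations forming $n$-fold rotational symmetry, alternately preserving and reversing colour with the smallest rotation reversing colour, and no reflections; $dn'$ ($n$ even) has the same rotations as $cn'$ plus $n$ lines of reflection, half preserving and half reversing colour; $d'n$ ($n\ge1$) consists of $n$ colour-preserving rotations forming $n$-fold symmetry and $n$ lines of reflection all reversing colour. A center of flip-two-fold rotation has rotations $\{e,\overline{r_{180}}\}$; a center of flip-four-fold rotation has rotations $\{e,\overline{r_{90}},r_{180},\overline{r_{270}}\}$.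 A two-colour rosette group is compatible with GHPs if some GHP has symmetry group of exactly that type. *)

theory Defs
  imports "HOL-Analysis.Analysis"
begin

section \<open>Generating strings of generalized hitomezashi patterns\<close>

text \<open>A binary string is a \<open>bool list\<close>, with entry 1 rendered as \<open>True\<close>; the reverse
  of a string is \<^const>\<open>rev\<close>. A GHP is given by its pair \<open>(x, y)\<close> of nonempty generating
  strings: \<open>x\<close> (of length \<open>n\<close>) determines the vertical lines of stitches from left to right, \<open>y\<close> (of
  length \<open>m\<close>) the horizontal lines from bottom to top, and \<open>True\<close> means that the first stitch
  of the line (from the bottom, respectively from the left) is on the front.\<close>

type_synonym ghp = "bool list \<times> bool list"

definition is_ghp :: "ghp \<Rightarrow> bool" where
  "is_ghp p \<longleftrightarrow> fst p \<noteq> [] \<and> snd p \<noteq> []"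

definition complement :: "bool list \<Rightarrow> bool list" where
  "complement a = map Not a"

definition reverse_complement :: "bool list \<Rightarrow> bool list" where
  "reverse_complement a = rev (complement a)"

definition flip_sides :: "ghp \<Rightarrow> ghp" where
  "flip_sides p = (complement (fst p), complement (snd p))"

datatype d4 = Id4 | Rot90 | Rot180 | Rot270 | RefH | RefV | RefD | RefA

fun act :: "d4 \<Rightarrow> ghp \<Rightarrow> ghp" where
  "act Id4 (x, y) = (x, y)"
| "act RefH (x, y) = (if even (length y) then (x, rev y) else (complement x, rev y))"
| "act RefV (x, y) = (if even (length x) then (rev x, y) else (rev x, complement y))"
| "act RefD (x, y) = (y, x)"
| "act RefA (x, y) = (if even (length x) then (rev y, rev x) else (reverse_complement y, reverse_complement x))"
| "act Rot90 (x, y) = (if even (length y) then (rev y, x) else (rev y, complement x))"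
| "act Rot270 (x, y) = (if even (length x) then (y, rev x) else (complement y, rev x))"
| "act Rot180 (x, y) =
     (if even (length y) then rev x else reverse_complement x,
      if even (length x) then rev y else reverse_complement y)"

text \<open>Diagonal reflections and quarter turns map the grid to itself only if it is a square.\<close>

definition admissible :: "d4 \<Rightarrow> ghp \<Rightarrow> bool" where
  "admissible s p \<longleftrightarrow>
     (s \<in> {RefD, RefA, Rot90, Rot270} \<longrightarrow> length (fst p) = length (snd p))"

section \<open>Coloured isometries fixing a point\<close>

text \<open>The plane is \<^typ>\<open>complex\<close> and the fixed point (for a GHP, the centre of its grid) is the
  origin. A coloured symmetry is a pair \<open>(f, c)\<close> of an isometry \<open>f\<close> fixing the origin and a flag
  \<open>c\<close> that is \<open>True\<close> iff the symmetry reverses the colours (a flip-symmetry).\<close>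

type_synonym csym = "(complex \<Rightarrow> complex) \<times> bool"

definition rot :: "real \<Rightarrow> complex \<Rightarrow> complex" where
  "rot \<theta> = (\<lambda>z. cis \<theta> * z)"

definition mirror_line :: "real \<Rightarrow> complex set" where
  "mirror_line \<phi> = range (\<lambda>t::real. t *\<^sub>R cis \<phi>)"

text \<open>The reflection across the line \<open>mirror_line \<phi>\<close> through the origin.\<close>

definition reflection :: "real \<Rightarrow> complex \<Rightarrow> complex" where
  "reflection \<phi> = (\<lambda>z. cis (2 * \<phi>) * cnj z)"

fun d4_map :: "d4 \<Rightarrow> complex \<Rightarrow> complex" where
  "d4_map Id4 = id"
| "d4_map Rot90 = rot (pi / 2)"
| "d4_map Rot180 = rot pi"
| "d4_map Rot270 = rot (3 * pi / 2)"
| "d4_map RefH = reflection 0"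
| "d4_map RefV = reflection (pi / 2)"
| "d4_map RefD = reflection (pi / 4)"
| "d4_map RefA = reflection (3 * pi / 4)"

definition symmetry_group :: "ghp \<Rightarrow> csym set" where
  "symmetry_group p =
     {(d4_map s, False) | s. admissible s p \<and> act s p = p} \<union>
     {(d4_map s, True) | s. admissible s p \<and> flip_sides (act s p) = p}"

definition two_colour_group :: "csym set \<Rightarrow> bool" where
  "two_colour_group G \<longleftrightarrow>
     (\<forall>(f, c) \<in> G. orthogonal_transformation f) \<and>
     (id, False) \<in> G \<and>
     (\<forall>(f, c) \<in> G. \<forall>(g, d) \<in> G. (f \<circ> g, c \<noteq> d) \<in> G) \<and>
     (\<forall>(f, c) \<in> G. (inv f, c) \<in> G) \<and>
     (\<exists>f. (f, True) \<in> G)"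

definition rotations :: "csym set \<Rightarrow> csym set" where
  "rotations G = {(f, c) \<in> G. f \<in> range rot}"

text \<open>The lines of reflection (\<open>c = False\<close>) and of flip-reflection (\<open>c = True\<close>).\<close>

definition reflection_lines :: "bool \<Rightarrow> csym set \<Rightarrow> complex set set" where
  "reflection_lines c G = {mirror_line \<phi> | \<phi>. (reflection \<phi>, c) \<in> G}"

section \<open>Two-colour rosette groups\<close>

text \<open>\<open>C_prime n\<close>, \<open>D_prime n\<close> and \<open>Prime_D n\<close> are the types written $cn'$, $dn'$ and $d'n$.
  The admissible values of \<open>n\<close> are enforced by \<open>has_type\<close>.\<close>

datatype rosette_type = C_prime nat | D_prime nat | Prime_D nat

definition alternating_rotations :: "nat \<Rightarrow> csym set" where
  "alternating_rotations n = {(rot (2 * pi * real k / real n), odd k) | k. k < n}"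

definition preserving_rotations :: "nat \<Rightarrow> csym set" where
  "preserving_rotations n = {(rot (2 * pi * real k / real n), False) | k. k < n}"

fun has_type :: "csym set \<Rightarrow> rosette_type \<Rightarrow> bool" where
  "has_type G (C_prime n) \<longleftrightarrow>
     two_colour_group G \<and> n > 0 \<and> even n \<and>
     rotations G = alternating_rotations n \<and>
     reflection_lines False G = {} \<and> reflection_lines True G = {}"
| "has_type G (D_prime n) \<longleftrightarrow>
     two_colour_group G \<and> n > 0 \<and> even n \<and>
     rotations G = alternating_rotations n \<and>
     card (reflection_lines False G) = n div 2 \<and>
     card (reflection_lines True G) = n div 2"
| "has_type G (Prime_D n) \<longleftrightarrow>
     two_colour_group G \<and> n > 0 \<and>
     rotations G = preserving_rotations n \<and>
     reflection_lines False G = {} \<and> card (reflection_lines True G) = n"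

definition ghp_compatible :: "rosette_type \<Rightarrow> bool" where
  "ghp_compatible T \<longleftrightarrow> (\<exists>p. is_ghp p \<and> has_type (symmetry_group p) T)"

definition flip_two_fold_centre :: "csym set \<Rightarrow> bool" where
  "flip_two_fold_centre G \<longleftrightarrow> rotations G = {(id, False), (rot pi, True)}"

definition flip_four_fold_centre :: "csym set \<Rightarrow> bool" where
  "flip_four_fold_centre G \<longleftrightarrow>
     rotations G =
       {(id, False), (rot (pi / 2), True), (rot pi, False), (rot (3 * pi / 2), True)}"

end

theory Submission
  imports Defs
begin

text \<open>Each \<open>d4_map s\<close> has order dividing 4, which forces \<open>n\<close> to divide 4 in any compatible type.
  A string is never its own complement, and a string of odd length is never its own
  reverse-complement. This excludes flip-reflections across the horizontal and vertical midlines.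
  A flip-reflection across a diagonal together with a colour-preserving half turn, and likewise a
  flip-quarter-turn, forces \<open>x\<close> to be a palindrome of even length, so that the reflection across the
  vertical midline preserves colours; this excludes \<open>d'2\<close>, \<open>d'4\<close> and \<open>c4'\<close>. The four remaining
  types are realised by the strings \<open>(110, 001)\<close>, \<open>(10, 1010)\<close>, \<open>(1, 0)\<close> and \<open>(11, 00)\<close>.\<close>

section \<open>Rotations, reflections and their mirror lines\<close>

lemma rot_0: "rot 0 = id"
  by (simp add: rot_def fun_eq_iff)

lemma reflection_eq_iff: "reflection a = reflection b \<longleftrightarrow> cis (2 * a) = cis (2 * b)"
  by (auto simp: reflection_def fun_eq_iff dest: spec[of _ 1])

text \<open>At 1 the two unit factors agree, at \<open>\<i>\<close> conjugation flips one sign, so a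
  unit would equal its own negative.\<close>

lemma rot_neq_reflection: "rot a \<noteq> reflection b"
proof
  assume eq: "rot a = reflection b"
  have "cis a = cis (2 * b)" "cis a * \<i> = - (cis (2 * b) * \<i>)"
    using fun_cong[OF eq, of 1] fun_cong[OF eq, of \<i>] by (simp_all add: rot_def reflection_def)
  then show False by simp
qed

lemma cis_double: "cis (2 * a) = (cis a)\<^sup>2"
  by (simp add: power2_eq_square cis_mult)

text \<open>A line fixes its unit direction up to sign, and a reflection depends only on the square
  of that direction. Counting lines thus becomes counting maps.\<close>

lemma mirror_line_eq_iff: "mirror_line a = mirror_line b \<longleftrightarrow> reflection a = reflection b"
proof
  assume eq: "mirror_line a = mirror_line b"
  have "cis a \<in> mirror_line b" unfolding eq[symmetric]
    unfolding mirror_line_def by (rule range_eqI[where x = 1]) simp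
  then obtain t where t: "cis a = t *\<^sub>R cis b" by (auto simp: mirror_line_def)
  from arg_cong[OF this, of norm] have "t\<^sup>2 = 1" by (simp add: abs_square_eq_1)
  moreover have "(cis a)\<^sup>2 = t\<^sup>2 *\<^sub>R (cis b)\<^sup>2"
    by (simp only: t power2_eq_square mult_scaleR_left mult_scaleR_right scaleR_scaleR)
  ultimately have "(cis a)\<^sup>2 = (cis b)\<^sup>2" by simp
  then show "reflection a = reflection b" by (simp add: reflection_eq_iff cis_double)
next
  assume "reflection a = reflection b"
  then have "(cis a)\<^sup>2 = (cis b)\<^sup>2" by (simp add: reflection_eq_iff cis_double)
  then consider "cis a = cis b" | "cis a = - cis b" by (auto simp: power2_eq_iff)
  then show "mirror_line a = mirror_line b"
  proof cases
    case 2
    then have neg: "t *\<^sub>R cis a = (- t) *\<^sub>R cis b" "t *\<^sub>R cis b = (- t) *\<^sub>R cis a" for t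
      by simp_all
    show ?thesis unfolding mirror_line_def
    proof (intro equalityI image_subsetI)
      show "t *\<^sub>R cis a \<in> range (\<lambda>t. t *\<^sub>R cis b)" for t unfolding neg(1) by (rule rangeI)
      show "t *\<^sub>R cis b \<in> range (\<lambda>t. t *\<^sub>R cis a)" for t unfolding neg(2) by (rule rangeI)
    qed
  qed (simp add: mirror_line_def)
qed

text \<open>The mirror turns by half the angle because \<open>reflection\<close> doubles its
  argument. This locates further lines once one is known.\<close>

lemma rot_comp_reflection: "rot a \<circ> reflection b = reflection (b + a / 2)"
  by (simp add: rot_def reflection_def fun_eq_iff cis_mult ring_distribs add.commute
      flip: mult.assoc)

text \<open>Mirror angles matter only modulo \<open>pi\<close>, and no integer multiple of
  \<open>pi\<close> lies strictly between 0 and \<open>pi\<close>.\<close>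

lemma reflection_neq_shift:
  assumes "0 < d" "d < pi"
  shows "reflection (a + d) \<noteq> reflection a"
proof
  assume "reflection (a + d) = reflection a"
  then have "cis (2 * a) * cis (2 * d) = cis (2 * a)"
    by (simp add: reflection_eq_iff cis_mult ring_distribs)
  then have "cis (2 * d) = 1" by simp
  then have "cos (2 * d) = 1" by (simp add: complex_eq_iff)
  then obtain k :: int where "2 * d = real_of_int k * 2 * pi" by (auto simp: cos_one_2pi_int)
  then have "d = real_of_int k * pi" by simp
  with assms have "0 < real_of_int k" "real_of_int k < 1"
    by (simp_all add: zero_less_mult_iff)
  then have "0 < k" "k < 1" by simp_all
  then show False by simp
qed

lemma cis_3_pi_half: "cis (3 * pi / 2) = - \<i>"
  using cis_mult[of pi "pi / 2"] by (simp add: field_simps)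

section \<open>The group of the square acting on patterns\<close>

text \<open>An angle-free form of the eight maps; later case checks use it in place of
  \<open>d4_map.simps\<close>.\<close>

lemma d4_map_apply:
  "d4_map Id4 z = z" "d4_map Rot90 z = \<i> * z" "d4_map Rot180 z = - z" "d4_map Rot270 z = - \<i> * z"
  "d4_map RefH z = cnj z" "d4_map RefV z = - cnj z"
  "d4_map RefD z = \<i> * cnj z" "d4_map RefA z = - \<i> * cnj z"
  by (simp_all add: rot_def reflection_def cis_3_pi_half)

text \<open>The images of 1 and \<open>\<i>\<close> already tell the eight maps apart.\<close>

lemma inj_d4_map: "inj d4_map"
proof (rule injI)
  fix s t assume "d4_map s = d4_map t"
  then have "d4_map s 1 = d4_map t 1" "d4_map s \<i> = d4_map t \<i>" by simp_all
  then show "s = t"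
    by (cases s; cases t) (simp_all add: d4_map_apply complex_eq_iff del: d4_map.simps)
qed

definition reflections4 :: "d4 set" where
  "reflections4 = {RefH, RefV, RefD, RefA}"

text \<open>The last clause is a dummy value for rotations; the angle has meaning only on
  \<open>reflections4\<close>.\<close>

fun mirror_angle :: "d4 \<Rightarrow> real" where
  "mirror_angle RefH = 0"
| "mirror_angle RefV = pi / 2"
| "mirror_angle RefD = pi / 4"
| "mirror_angle RefA = 3 * pi / 4"
| "mirror_angle _ = 0"

lemma d4_map_reflection: "s \<in> reflections4 \<Longrightarrow> d4_map s = reflection (mirror_angle s)"
  by (auto simp: reflections4_def)

lemma d4_map_in_range_rot_iff: "d4_map s \<in> range rot \<longleftrightarrow> s \<notin> reflections4"
proof (cases "s \<in> reflections4")
  case True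
  then show ?thesis using rot_neq_reflection[symmetric] by (auto simp: d4_map_reflection)
next
  case False
  then show ?thesis by (cases s) (auto simp: reflections4_def simp flip: rot_0)
qed

lemma orthogonal_d4_map: "orthogonal_transformation (d4_map s)"
proof -
  have "linear (d4_map s)"
    by (rule linearI; cases s) (simp_all add: d4_map_apply algebra_simps del: d4_map.simps)
  moreover have "norm (d4_map s z) = norm z" for z
    by (cases s) (simp_all add: d4_map_apply norm_mult del: d4_map.simps)
  ultimately show ?thesis by (simp add: orthogonal_transformation)
qed

text \<open>Left multiplication by \<open>Rot90\<close>; likewise \<open>mirror_H\<close> below is
  left multiplication by \<open>RefH\<close>.\<close>

fun quarter_turn :: "d4 \<Rightarrow> d4" where
  "quarter_turn Id4 = Rot90"
| "quarter_turn Rot90 = Rot180"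
| "quarter_turn Rot180 = Rot270"
| "quarter_turn Rot270 = Id4"
| "quarter_turn RefH = RefD"
| "quarter_turn RefD = RefV"
| "quarter_turn RefV = RefA"
| "quarter_turn RefA = RefH"

fun mirror_H :: "d4 \<Rightarrow> d4" where
  "mirror_H Id4 = RefH"
| "mirror_H Rot90 = RefA"
| "mirror_H Rot180 = RefV"
| "mirror_H Rot270 = RefD"
| "mirror_H RefH = Id4"
| "mirror_H RefA = Rot90"
| "mirror_H RefV = Rot180"
| "mirror_H RefD = Rot270"

text \<open>The left factor is written as a power of \<open>Rot90\<close>, followed on the right by
  \<open>RefH\<close> if it is a reflection.\<close>

fun d4_comp :: "d4 \<Rightarrow> d4 \<Rightarrow> d4" where
  "d4_comp Id4 t = t"
| "d4_comp Rot90 t = quarter_turn t"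
| "d4_comp Rot180 t = quarter_turn (quarter_turn t)"
| "d4_comp Rot270 t = quarter_turn (quarter_turn (quarter_turn t))"
| "d4_comp RefH t = mirror_H t"
| "d4_comp RefD t = quarter_turn (mirror_H t)"
| "d4_comp RefV t = quarter_turn (quarter_turn (mirror_H t))"
| "d4_comp RefA t = quarter_turn (quarter_turn (quarter_turn (mirror_H t)))"

lemma d4_map_comp: "d4_map (d4_comp s t) = d4_map s \<circ> d4_map t"
proof
  fix z show "d4_map (d4_comp s t) z = (d4_map s \<circ> d4_map t) z"
    by (cases s; cases t) (simp_all add: d4_map_apply flip: mult.assoc del: d4_map.simps)
qed

section \<open>Complements of strings and compatibility of the action with composition\<close>

lemma length_complement [simp]: "length (complement a) = length a"
  by (simp add: complement_def)

lemma complement_complement [simp]: "complement (complement a) = a"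
  by (simp add: complement_def comp_def)

lemma rev_complement [simp]: "rev (complement a) = complement (rev a)"
  by (simp add: complement_def rev_map)

lemma reverse_complement_eq [simp]: "reverse_complement a = complement (rev a)"
  by (simp add: reverse_complement_def)

lemma complement_neq: "a \<noteq> [] \<Longrightarrow> complement a \<noteq> a"
  by (cases a) (auto simp: complement_def)

text \<open>The middle entry would have to equal its own negation.\<close>

lemma complement_rev_neq:
  assumes "odd (length a)"
  shows "complement (rev a) \<noteq> a"
proof
  assume eq: "complement (rev a) = a"
  obtain k where k: "length a = 2 * k + 1" using assms by (auto elim: oddE)
  then have "complement (rev a) ! k = (\<not> a ! k)"
    by (simp add: complement_def rev_nth)
  with eq show False by simp
qed

text \<open>Admissibility gives equal lengths whenever a map exchanges the two strings, so the
  parity tests of both actions agree.\<close>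

lemma act_comp:
  assumes "admissible s p" "admissible t p"
  shows "act (d4_comp s t) p = act s (act t p)"
  using assms by (cases p; cases s; cases t) (simp_all add: admissible_def)

lemma admissible_comp: "admissible s p \<Longrightarrow> admissible t p \<Longrightarrow> admissible (d4_comp s t) p"
  by (cases s; cases t) (simp_all add: admissible_def)

lemma flip_sides_act: "flip_sides (act s p) = act s (flip_sides p)"
  by (cases p; cases s) (simp_all add: flip_sides_def)

lemma flip_sides_flip_sides [simp]: "flip_sides (flip_sides p) = p"
  by (simp add: flip_sides_def)

section \<open>Symmetry groups of patterns\<close>

text \<open>The symmetry group in terms of the labels \<open>s\<close>, where membership is a
  question about strings only.\<close>

definition stabilizer :: "ghp \<Rightarrow> (d4 \<times> bool) set" where
  "stabilizer p = {(s, c). admissible s p \<and> (if c then flip_sides (act s p) else act s p) = p}"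

lemma symmetry_group_eq: "symmetry_group p = {(d4_map s, c) | s c. (s, c) \<in> stabilizer p}"
  unfolding symmetry_group_def stabilizer_def by (auto split: if_splits)

lemma d4_map_in_symmetry_group_iff [simp]:
  "(d4_map s, c) \<in> symmetry_group p \<longleftrightarrow> (s, c) \<in> stabilizer p"
  by (auto simp: symmetry_group_eq dest: injD[OF inj_d4_map])

lemma symmetry_groupE:
  assumes "(f, c) \<in> symmetry_group p"
  obtains s where "f = d4_map s" "(s, c) \<in> stabilizer p"
  using assms by (auto simp: symmetry_group_eq)

text \<open>Flipping is an involution that commutes with the action, so colour flags add modulo
  2.\<close>

lemma stabilizer_comp:
  assumes "(s, c) \<in> stabilizer p" "(t, d) \<in> stabilizer p"
  shows "(d4_comp s t, c \<noteq> d) \<in> stabilizer p"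
proof -
  have eq: "act (d4_comp s t) p = act s (act t p)" and adm: "admissible (d4_comp s t) p"
    using assms act_comp admissible_comp by (auto simp: stabilizer_def)
  \<comment> \<open>A flip-symmetry satisfies \<open>flip_sides (act s p) = p\<close>; a second flip
    moves \<open>flip_sides\<close> to the right-hand side.\<close>
  have "act s p = (if c then flip_sides p else p)" "act t p = (if d then flip_sides p else p)"
    using assms by (auto simp: stabilizer_def split: if_splits) (metis flip_sides_flip_sides)+
  then show ?thesis
    using adm by (cases c; cases d) (simp_all add: stabilizer_def eq flip_sides_act[symmetric])
qed

lemma symmetry_group_comp:
  assumes "(f, c) \<in> symmetry_group p" "(g, d) \<in> symmetry_group p"
  shows "(f \<circ> g, c \<noteq> d) \<in> symmetry_group p"
proof -
  obtain s t where "f = d4_map s" "(s, c) \<in> stabilizer p" "g = d4_map t" "(t, d) \<in> stabilizer p"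
    using assms by (elim symmetry_groupE)
  then show ?thesis using stabilizer_comp by (simp flip: d4_map_comp)
qed

text \<open>This supplies inverses as cubes and later bounds the order of a rotation.\<close>

lemma d4_map_pow4: "(d4_map s \<circ> (d4_map s \<circ> d4_map s)) \<circ> d4_map s = id"
  by (rule ext, cases s) (simp_all add: d4_map_apply flip: mult.assoc del: d4_map.simps)

lemma symmetry_group_inv:
  assumes "(f, c) \<in> symmetry_group p"
  shows "(inv f, c) \<in> symmetry_group p"
proof -
  obtain s where s: "f = d4_map s" using assms by (elim symmetry_groupE)
  have "inv f = f \<circ> (f \<circ> f)"
    using d4_map_pow4[of s] unfolding s by (intro inv_unique_comp) (simp_all add: comp_assoc)
  \<comment> \<open>Three copies of the flag combine to \<open>c\<close> again.\<close>
  moreover have "(f \<circ> (f \<circ> f), c \<noteq> (c \<noteq> c)) \<in> symmetry_group p"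
    by (intro symmetry_group_comp assms)
  ultimately show ?thesis by simp
qed

lemma two_colour_group_symmetry_group:
  assumes "(s, True) \<in> stabilizer p"
  shows "two_colour_group (symmetry_group p)"
proof -
  have "(Id4, False) \<in> stabilizer p"
    by (cases p) (simp add: stabilizer_def admissible_def)
  then have "(id, False) \<in> symmetry_group p"
    unfolding d4_map_in_symmetry_group_iff[symmetric] by simp
  moreover have "\<exists>f. (f, True) \<in> symmetry_group p"
    using assms d4_map_in_symmetry_group_iff by blast
  moreover have "orthogonal_transformation f" if "(f, c) \<in> symmetry_group p" for f c
    using that orthogonal_d4_map by (auto elim: symmetry_groupE)
  ultimately show ?thesis
    unfolding two_colour_group_def using symmetry_group_comp symmetry_group_inv by blast
qed

lemma rotations_symmetry_group:
  "rotations (symmetry_group p) =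
     (\<lambda>(s, c). (d4_map s, c)) ` {(s, c) \<in> stabilizer p. s \<notin> reflections4}"
proof -
  have "rotations (symmetry_group p) = {(d4_map s, c) | s c. (s, c) \<in> stabilizer p \<and> s \<notin> reflections4}"
    unfolding rotations_def symmetry_group_eq d4_map_in_range_rot_iff[symmetric] by blast
  then show ?thesis by (simp add: image_def) blast
qed

lemma reflection_lines_symmetry_group:
  "reflection_lines c (symmetry_group p) =
     (\<lambda>s. mirror_line (mirror_angle s)) ` {s \<in> reflections4. (s, c) \<in> stabilizer p}"
proof (intro equalityI subsetI)
  fix l assume "l \<in> reflection_lines c (symmetry_group p)"
  then obtain a where l: "l = mirror_line a" and a: "(reflection a, c) \<in> symmetry_group p"
    by (auto simp: reflection_lines_def)
  from a obtain s where s: "reflection a = d4_map s" "(s, c) \<in> stabilizer p"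
    by (elim symmetry_groupE)
  have "s \<in> reflections4"
    using d4_map_in_range_rot_iff[of s] rot_neq_reflection[symmetric] by (auto simp flip: s(1))
  then show "l \<in> (\<lambda>s. mirror_line (mirror_angle s)) ` {s \<in> reflections4. (s, c) \<in> stabilizer p}"
    using s by (auto simp: l mirror_line_eq_iff d4_map_reflection)
next
  fix l assume "l \<in> (\<lambda>s. mirror_line (mirror_angle s)) ` {s \<in> reflections4. (s, c) \<in> stabilizer p}"
  then obtain s where s: "s \<in> reflections4" "(s, c) \<in> stabilizer p" "l = mirror_line (mirror_angle s)"
    by auto
  then have "(reflection (mirror_angle s), c) \<in> symmetry_group p"
    by (simp flip: d4_map_reflection)
  then show "l \<in> reflection_lines c (symmetry_group p)"
    using s(3) by (auto simp: reflection_lines_def)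
qed

text \<open>Distinct reflections of the square have distinct mirror lines, so labels may be counted
  instead.\<close>

lemma card_reflection_lines_symmetry_group:
  "card (reflection_lines c (symmetry_group p)) = card {s \<in> reflections4. (s, c) \<in> stabilizer p}"
proof -
  have "inj_on (\<lambda>s. mirror_line (mirror_angle s)) reflections4"
    using inj_d4_map by (auto simp: inj_on_def mirror_line_eq_iff simp flip: d4_map_reflection)
  then have "inj_on (\<lambda>s. mirror_line (mirror_angle s)) {s \<in> reflections4. (s, c) \<in> stabilizer p}"
    by (rule inj_on_subset) auto
  then show ?thesis by (simp add: reflection_lines_symmetry_group card_image)
qed

section \<open>Small rosette groups\<close>

lemma preserving_rotations_1: "preserving_rotations 1 = {(id, False)}"
  by (auto simp: preserving_rotations_def rot_0)

lemma alternating_rotations_image: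
  "alternating_rotations n = (\<lambda>k. (rot (2 * pi * real k / real n), odd k)) ` {..<n}"
  unfolding alternating_rotations_def by blast

lemma alternating_rotations_2: "alternating_rotations 2 = {(id, False), (rot pi, True)}"
proof -
  have "{..<2::nat} = {0, 1}" by auto
  then show ?thesis
    by (simp add: alternating_rotations_image rot_0)
qed

lemma alternating_rotations_4:
  "alternating_rotations 4 =
     {(id, False), (rot (pi / 2), True), (rot pi, False), (rot (3 * pi / 2), True)}"
proof -
  have "{..<4::nat} = {0, 1, 2, 3}" by auto
  then show ?thesis
    by (simp add: alternating_rotations_image rot_0 mult.commute[of pi])
qed

lemma reflection_lines_card_1E:
  assumes "card (reflection_lines c G) = 1"
  obtains a where "(reflection a, c) \<in> G" "reflection_lines c G = {mirror_line a}"
proof -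
  obtain l where l: "reflection_lines c G = {l}" using assms by (rule card_1_singletonE)
  then have "l \<in> reflection_lines c G" by simp
  then obtain a where "l = mirror_line a" "(reflection a, c) \<in> G"
    unfolding reflection_lines_def by blast
  with l that show thesis by blast
qed

lemma reflection_line_shift:
  assumes "two_colour_group G" "(rot a, d) \<in> rotations G" "(reflection b, c) \<in> G"
  shows "mirror_line (b + a / 2) \<in> reflection_lines (d \<noteq> c) G"
proof -
  have "(rot a \<circ> reflection b, d \<noteq> c) \<in> G"
    using assms unfolding two_colour_group_def rotations_def by blast
  then show ?thesis by (auto simp: rot_comp_reflection reflection_lines_def)
qed

text \<open>Composing the reflection with the flip half turn rotates its line by
  \<open>pi / 2\<close> and reverses its colour; the cardinalities leave no other line.\<close>

lemma D_prime_2_lines: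
  assumes "has_type G (D_prime 2)"
  shows "\<exists>a. reflection_lines False G = {mirror_line a} \<and>
             reflection_lines True G = {mirror_line (a + pi / 2)}"
proof -
  have G: "two_colour_group G" "(rot pi, True) \<in> rotations G"
    and c: "card (reflection_lines False G) = 1" "card (reflection_lines True G) = 1"
    using assms by (simp_all add: alternating_rotations_2)
  from c(1) obtain a where a: "(reflection a, False) \<in> G" "reflection_lines False G = {mirror_line a}"
    by (rule reflection_lines_card_1E)
  have "mirror_line (a + pi / 2) \<in> reflection_lines True G"
    using reflection_line_shift[OF G a(1)] by simp
  with c(2) have "reflection_lines True G = {mirror_line (a + pi / 2)}"
    by (metis card_1_singletonE singletonD)
  with a(2) show ?thesis by blast
qed

text \<open>From one colour-preserving line, the half turn yields the other, and the two flip
  quarter turns yield the flip lines at \<open>pi / 4\<close> and \<open>3 * pi / 4\<close>.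
  Distinctness and the cardinalities complete both sets.\<close>

lemma D_prime_4_lines:
  assumes "has_type G (D_prime 4)"
  shows "\<exists>a. reflection_lines False G = {mirror_line a, mirror_line (a + pi / 2)} \<and>
             reflection_lines True G = {mirror_line (a + pi / 4), mirror_line (a + 3 * pi / 4)}"
proof -
  have G: "two_colour_group G" "(rot pi, False) \<in> rotations G"
      "(rot (pi / 2), True) \<in> rotations G" "(rot (3 * pi / 2), True) \<in> rotations G"
    and c: "card (reflection_lines False G) = 2" "card (reflection_lines True G) = 2"
    using assms by (simp_all add: alternating_rotations_4)
  from c(1) have "reflection_lines False G \<noteq> {}" by auto
  then obtain a where a: "(reflection a, False) \<in> G" by (auto simp: reflection_lines_def)
  have two: "A = {x, y}" if "card A = 2" "x \<in> A" "y \<in> A" "x \<noteq> y" for A :: "complex set set" and x y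
    using that by (auto simp: card_2_iff)
  have "reflection_lines False G = {mirror_line a, mirror_line (a + pi / 2)}"
  proof (rule two[OF c(1)])
    show "mirror_line a \<in> reflection_lines False G" using a by (auto simp: reflection_lines_def)
    show "mirror_line (a + pi / 2) \<in> reflection_lines False G"
      using reflection_line_shift[OF G(1,2) a] by simp
    show "mirror_line a \<noteq> mirror_line (a + pi / 2)"
      using reflection_neq_shift[of "pi / 2" a] by (auto simp: mirror_line_eq_iff)
  qed
  moreover have "reflection_lines True G = {mirror_line (a + pi / 4), mirror_line (a + 3 * pi / 4)}"
  proof (rule two[OF c(2)])
    show "mirror_line (a + pi / 4) \<in> reflection_lines True G"
      using reflection_line_shift[OF G(1,3) a] by simp
    show "mirror_line (a + 3 * pi / 4) \<in> reflection_lines True G"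
      using reflection_line_shift[OF G(1,4) a] by simp
    show "mirror_line (a + pi / 4) \<noteq> mirror_line (a + 3 * pi / 4)"
      using reflection_neq_shift[of "pi / 2" "a + pi / 4"]
      by (auto simp: mirror_line_eq_iff add.assoc)
  qed
  ultimately show ?thesis by blast
qed

section \<open>Compatible types\<close>

lemma stabilizer_Prime_D_1:
  "stabilizer ([True, True, False], [False, False, True]) = {(Id4, False), (RefD, True)}"
proof -
  have iff: "(s, c) \<in> stabilizer ([True, True, False], [False, False, True]) \<longleftrightarrow>
      (s, c) \<in> {(Id4, False), (RefD, True)}" for s c
    \<comment> \<open>Sixteen explicit comparisons. The strings are complements of each other, so
      the diagonal flip-reflection survives.\<close>
    by (cases s; cases c)
      (simp_all add: stabilizer_def admissible_def flip_sides_def complement_def)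
  show ?thesis by (simp only: set_eq_iff split_paired_All iff simp_thms)
qed

text \<open>Unequal lengths exclude diagonals and quarter turns. Both strings are their own
  reverse-complements and have even length, so the flip half turn survives.\<close>

lemma stabilizer_C_prime_2:
  "stabilizer ([True, False], [True, False, True, False]) = {(Id4, False), (Rot180, True)}"
proof -
  have iff: "(s, c) \<in> stabilizer ([True, False], [True, False, True, False]) \<longleftrightarrow>
      (s, c) \<in> {(Id4, False), (Rot180, True)}" for s c
    by (cases s; cases c)
      (simp_all add: stabilizer_def admissible_def flip_sides_def complement_def)
  show ?thesis by (simp only: set_eq_iff split_paired_All iff simp_thms)
qed

lemma stabilizer_D_prime_2:
  "stabilizer ([True], [False]) = {(Id4, False), (Rot180, True), (RefA, False), (RefD, True)}"
proof -
  have iff: "(s, c) \<in> stabilizer ([True], [False]) \<longleftrightarrow>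
      (s, c) \<in> {(Id4, False), (Rot180, True), (RefA, False), (RefD, True)}" for s c
    by (cases s; cases c)
      (simp_all add: stabilizer_def admissible_def flip_sides_def complement_def)
  show ?thesis by (simp only: set_eq_iff split_paired_All iff simp_thms)
qed

text \<open>Both strings are palindromes of even length and complementary: maps keeping them in
  place preserve colours, maps exchanging them reverse colours.\<close>

lemma stabilizer_D_prime_4:
  "stabilizer ([True, True], [False, False]) =
     {(Id4, False), (Rot90, True), (Rot180, False), (Rot270, True),
      (RefH, False), (RefV, False), (RefD, True), (RefA, True)}"
proof -
  have iff: "(s, c) \<in> stabilizer ([True, True], [False, False]) \<longleftrightarrow>
      (s, c) \<in> {(Id4, False), (Rot90, True), (Rot180, False), (Rot270, True),
        (RefH, False), (RefV, False), (RefD, True), (RefA, True)}" for s c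
    by (cases s; cases c)
      (simp_all add: stabilizer_def admissible_def flip_sides_def complement_def)
  show ?thesis by (simp only: set_eq_iff split_paired_All iff simp_thms)
qed

lemma ghp_compatible_Prime_D_1: "ghp_compatible (Prime_D 1)"
proof -
  let ?p = "([True, True, False], [False, False, True])"
  note st = stabilizer_Prime_D_1
  have "two_colour_group (symmetry_group ?p)"
    by (rule two_colour_group_symmetry_group[of RefD]) (simp add: st)
  moreover have "rotations (symmetry_group ?p) = preserving_rotations 1"
  proof -
    have "{(s, c) \<in> stabilizer ?p. s \<notin> reflections4} = {(Id4, False)}"
      by (auto simp: st reflections4_def)
    then show ?thesis by (simp add: rotations_symmetry_group preserving_rotations_1[simplified])
  qed
  moreover have "{s \<in> reflections4. (s, True) \<in> stabilizer ?p} = {RefD}"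
    "{s \<in> reflections4. (s, False) \<in> stabilizer ?p} = {}"
    by (auto simp: st reflections4_def)
  ultimately have "has_type (symmetry_group ?p) (Prime_D 1)"
    \<comment> \<open>First the flip lines are counted, then the set of colour-preserving lines is
      seen to be empty.\<close>
    by (simp add: card_reflection_lines_symmetry_group) (simp add: reflection_lines_symmetry_group)
  moreover have "is_ghp ?p" by (simp add: is_ghp_def)
  ultimately show ?thesis unfolding ghp_compatible_def by blast
qed

lemma ghp_compatible_C_prime_2: "ghp_compatible (C_prime 2)"
proof -
  let ?p = "([True, False], [True, False, True, False])"
  note st = stabilizer_C_prime_2
  have "two_colour_group (symmetry_group ?p)"
    by (rule two_colour_group_symmetry_group[of Rot180]) (simp add: st)
  moreover have "rotations (symmetry_group ?p) = alternating_rotations 2"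
  proof -
    have "{(s, c) \<in> stabilizer ?p. s \<notin> reflections4} = {(Id4, False), (Rot180, True)}"
      by (auto simp: st reflections4_def)
    then show ?thesis by (simp add: rotations_symmetry_group alternating_rotations_2)
  qed
  moreover have "{s \<in> reflections4. (s, c) \<in> stabilizer ?p} = {}" for c
    by (auto simp: st reflections4_def)
  ultimately have "has_type (symmetry_group ?p) (C_prime 2)"
    by (simp add: reflection_lines_symmetry_group)
  moreover have "is_ghp ?p" by (simp add: is_ghp_def)
  ultimately show ?thesis unfolding ghp_compatible_def by blast
qed

lemma ghp_compatible_D_prime_2: "ghp_compatible (D_prime 2)"
proof -
  let ?p = "([True], [False])"
  note st = stabilizer_D_prime_2
  have "two_colour_group (symmetry_group ?p)"
    by (rule two_colour_group_symmetry_group[of RefD]) (simp add: st)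
  moreover have "rotations (symmetry_group ?p) = alternating_rotations 2"
  proof -
    have "{(s, c) \<in> stabilizer ?p. s \<notin> reflections4} = {(Id4, False), (Rot180, True)}"
      by (auto simp: st reflections4_def)
    then show ?thesis by (simp add: rotations_symmetry_group alternating_rotations_2)
  qed
  moreover have "{s \<in> reflections4. (s, True) \<in> stabilizer ?p} = {RefD}"
    "{s \<in> reflections4. (s, False) \<in> stabilizer ?p} = {RefA}"
    by (auto simp: st reflections4_def)
  ultimately have "has_type (symmetry_group ?p) (D_prime 2)"
    by (simp add: card_reflection_lines_symmetry_group)
  moreover have "is_ghp ?p" by (simp add: is_ghp_def)
  ultimately show ?thesis unfolding ghp_compatible_def by blast
qed

lemma ghp_compatible_D_prime_4: "ghp_compatible (D_prime 4)"
proof -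
  let ?p = "([True, True], [False, False])"
  note st = stabilizer_D_prime_4
  have "two_colour_group (symmetry_group ?p)"
    by (rule two_colour_group_symmetry_group[of RefD]) (simp add: st)
  moreover have "rotations (symmetry_group ?p) = alternating_rotations 4"
  proof -
    have "{(s, c) \<in> stabilizer ?p. s \<notin> reflections4} =
        {(Id4, False), (Rot90, True), (Rot180, False), (Rot270, True)}"
      by (auto simp: st reflections4_def)
    then show ?thesis by (simp add: rotations_symmetry_group alternating_rotations_4)
  qed
  moreover have "{s \<in> reflections4. (s, True) \<in> stabilizer ?p} = {RefD, RefA}"
    "{s \<in> reflections4. (s, False) \<in> stabilizer ?p} = {RefH, RefV}"
    by (auto simp: st reflections4_def)
  ultimately have "has_type (symmetry_group ?p) (D_prime 4)"
    by (simp add: card_reflection_lines_symmetry_group)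
  moreover have "is_ghp ?p" by (simp add: is_ghp_def)
  ultimately show ?thesis unfolding ghp_compatible_def by blast
qed

section \<open>Exclusion of all other types\<close>

lemma dvd_4_nat:
  fixes n :: nat
  assumes "n dvd 4"
  shows "n = 1 \<or> n = 2 \<or> n = 4"
proof -
  have "n \<le> 4" using assms by (rule dvd_imp_le) simp
  then have "n = 0 \<or> n = 1 \<or> n = 2 \<or> n = 3 \<or> n = 4" by linarith
  then show ?thesis using assms by (elim disjE) simp_all
qed

text \<open>The fourth power of the rotation is the identity, so four times its angle is
  \<open>k\<close> full turns, that is, 4 equals \<open>k * n\<close>.\<close>

lemma rotation_order_dvd_4:
  assumes "(rot (2 * pi / real n), c) \<in> symmetry_group p" "n > 0"
  shows "n dvd 4"
proof -
  from assms(1) obtain s where s: "rot (2 * pi / real n) = d4_map s"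
    by (elim symmetry_groupE)
  define u where "u = cis (2 * pi / real n)"
  have "1 = ((d4_map s \<circ> (d4_map s \<circ> d4_map s)) \<circ> d4_map s) 1"
    unfolding d4_map_pow4 by simp
  also have "\<dots> = u ^ 4"
    unfolding s[symmetric] by (simp add: rot_def u_def power4_eq_xxxx)
  also have "u ^ 4 = cis (real 4 * (2 * pi / real n))"
    unfolding u_def by (rule Complex.DeMoivre)
  finally have "cis (real 4 * (2 * pi / real n)) = 1" ..
  then have "cos (4 * (2 * pi / real n)) = 1" by (simp add: complex_eq_iff)
  then obtain k :: int where "4 * (2 * pi / real n) = real_of_int k * 2 * pi"
    by (auto simp: cos_one_2pi_int)
  then have "real_of_int 4 = real_of_int (k * int n)"
    using assms(2) by (simp add: field_simps)
  then have "int n dvd int 4" by (metis dvd_triv_right of_int_eq_iff of_nat_numeral)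
  then show ?thesis by (simp only: int_dvd_int_iff)
qed

text \<open>For \<open>y\<close> of even length, \<open>x\<close> would be its own complement; for
  odd length, \<open>y\<close> would be its own reverse-complement.\<close>

lemma no_flip_RefH: "is_ghp p \<Longrightarrow> (RefH, True) \<notin> stabilizer p"
  by (cases p) (use complement_neq complement_rev_neq in
      \<open>auto simp: stabilizer_def flip_sides_def is_ghp_def split: if_splits\<close>)

lemma no_flip_RefV: "is_ghp p \<Longrightarrow> (RefV, True) \<notin> stabilizer p"
  by (cases p) (use complement_neq complement_rev_neq in
      \<open>auto simp: stabilizer_def flip_sides_def is_ghp_def split: if_splits\<close>)

lemma complement_eq_swap: "complement a = b \<longleftrightarrow> a = complement b"
  by auto

text \<open>In odd length the equations give \<open>y = x\<close> and make \<open>x\<close> its own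
  reverse-complement, which is impossible. In even length \<open>y\<close> is the complement of
  \<open>x\<close>, and substituting makes \<open>x\<close> a palindrome.\<close>

lemma flip_Rot90_imp_RefV:
  assumes "(Rot90, True) \<in> stabilizer p"
  shows "(RefV, False) \<in> stabilizer p"
proof -
  obtain x y where p: "p = (x, y)" by (cases p)
  show ?thesis
    using assms complement_rev_neq[of x] unfolding p
    by (auto simp: stabilizer_def flip_sides_def admissible_def complement_eq_swap split: if_splits)
qed

text \<open>The flip-reflection must be diagonal, so the lengths agree. The half turn then makes
  \<open>x\<close> a palindrome if its length is even, and its own reverse-complement, a
  contradiction, if odd.\<close>

lemma flip_reflection_Rot180_imp_RefV:
  assumes "is_ghp p" "(Rot180, False) \<in> stabilizer p"
    and "(s, True) \<in> stabilizer p" "s \<in> reflections4"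
  shows "(RefV, False) \<in> stabilizer p"
proof -
  obtain x y where p: "p = (x, y)" by (cases p)
  have "s = RefD \<or> s = RefA"
    using assms(1,3,4) no_flip_RefH no_flip_RefV unfolding reflections4_def by blast
  then have len: "length x = length y"
    using assms(3) unfolding p by (auto simp: stabilizer_def admissible_def)
  have "(if even (length x) then rev x else complement (rev x)) = x"
    using assms(2) len unfolding p by (cases "even (length y)") (simp_all add: stabilizer_def)
  then show ?thesis
    using complement_rev_neq[of x] unfolding p
    by (cases "even (length x)") (simp_all add: stabilizer_def admissible_def)
qed

lemma no_reflection_lines_imp_RefV:
  "reflection_lines False (symmetry_group p) = {} \<Longrightarrow> (RefV, False) \<notin> stabilizer p"
  by (auto simp: reflection_lines_symmetry_group reflections4_def)

lemma alternating_rotations_symmetry_group: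
  assumes "rotations (symmetry_group p) = alternating_rotations n" "n > 0" "even n"
  shows "n = 2 \<or> n = 4"
proof -
  have "1 < n" using assms(2,3) by presburger
  \<comment> \<open>Index 1, available since \<open>n\<close> exceeds 1, is the smallest rotation
    and reverses colours.\<close>
  then have "(rot (2 * pi * real 1 / real n), odd (1::nat)) \<in> alternating_rotations n"
    unfolding alternating_rotations_image by blast
  then have "(rot (2 * pi / real n), True) \<in> symmetry_group p"
    unfolding assms(1)[symmetric] rotations_def by simp
  then have "n dvd 4" using assms(2) by (rule rotation_order_dvd_4)
  with assms(3) show ?thesis using dvd_4_nat by fastforce
qed

lemma ghp_compatible_C_prime: "ghp_compatible (C_prime n) \<Longrightarrow> n = 2"
proof -
  assume "ghp_compatible (C_prime n)"
  then obtain p where n: "n > 0" "even n"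
    and rot: "rotations (symmetry_group p) = alternating_rotations n"
    and lines: "reflection_lines False (symmetry_group p) = {}"
    by (auto simp: ghp_compatible_def)
  have "n \<noteq> 4"
  proof
    assume "n = 4"
    then have "(d4_map Rot90, True) \<in> rotations (symmetry_group p)"
      by (simp add: rot alternating_rotations_4)
    then have "(Rot90, True) \<in> stabilizer p"
      unfolding rotations_def d4_map_in_symmetry_group_iff[symmetric] by simp
    then show False
      using flip_Rot90_imp_RefV no_reflection_lines_imp_RefV[OF lines] by blast
  qed
  then show "n = 2" using alternating_rotations_symmetry_group[OF rot n] by blast
qed

lemma ghp_compatible_D_prime: "ghp_compatible (D_prime n) \<Longrightarrow> n = 2 \<or> n = 4"
  using alternating_rotations_symmetry_group by (auto simp: ghp_compatible_def)

text \<open>Any larger \<open>n\<close> is even, so a colour-preserving half turn coexists with a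
  flip-reflection; together they create a forbidden colour-preserving reflection.\<close>

lemma ghp_compatible_Prime_D: "ghp_compatible (Prime_D n) \<Longrightarrow> n = 1"
proof (rule ccontr)
  assume "ghp_compatible (Prime_D n)" "n \<noteq> 1"
  then obtain p where p: "is_ghp p" and n: "n > 1"
    and rot: "rotations (symmetry_group p) = preserving_rotations n"
    and lines: "reflection_lines False (symmetry_group p) = {}"
    and card: "card (reflection_lines True (symmetry_group p)) = n"
    by (auto simp: ghp_compatible_def)
  have mem: "(rot (2 * pi * real k / real n), False) \<in> symmetry_group p" if "k < n" for k
  proof -
    have "(rot (2 * pi * real k / real n), False) \<in> rotations (symmetry_group p)"
      unfolding rot preserving_rotations_def using that by blast
    then show ?thesis by (simp add: rotations_def)
  qed
  have "n dvd 4" by (rule rotation_order_dvd_4[of n False p]) (use mem[of 1] n in auto)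
  then have "even n" using n dvd_4_nat by fastforce
  \<comment> \<open>The rotation of index \<open>k\<close> is the half turn.\<close>
  then obtain k where "n = 2 * k" by (elim evenE)
  with mem[of k] n have "(d4_map Rot180, False) \<in> symmetry_group p" by simp
  then have "(Rot180, False) \<in> stabilizer p" by (simp only: d4_map_in_symmetry_group_iff)
  moreover have "{s \<in> reflections4. (s, True) \<in> stabilizer p} \<noteq> {}"
    using card n unfolding card_reflection_lines_symmetry_group by (metis card.empty not_one_less_zero)
  ultimately show False
    using flip_reflection_Rot180_imp_RefV[OF p] no_reflection_lines_imp_RefV[OF lines] by blast
qed

theorem theorem3p6:
  "{T. ghp_compatible T} = {Prime_D 1, C_prime 2, D_prime 2, D_prime 4} \<and>
   card {T. ghp_compatible T} = 4 \<and>
   (\<forall>G. has_type G (Prime_D 1) \<longrightarrow>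
      (\<exists>\<phi>. reflection_lines True G = {mirror_line \<phi>})) \<and>
   (\<forall>G. has_type G (C_prime 2) \<longrightarrow> flip_two_fold_centre G) \<and>
   (\<forall>G. has_type G (D_prime 2) \<longrightarrow>
      flip_two_fold_centre G \<and>
      (\<exists>\<phi>. reflection_lines False G = {mirror_line \<phi>} \<and>
           reflection_lines True G = {mirror_line (\<phi> + pi / 2)})) \<and>
   (\<forall>G. has_type G (D_prime 4) \<longrightarrow>
      flip_four_fold_centre G \<and>
      (\<exists>\<phi>. reflection_lines False G = {mirror_line \<phi>, mirror_line (\<phi> + pi / 2)} \<and>
           reflection_lines True G = {mirror_line (\<phi> + pi / 4), mirror_line (\<phi> + 3 * pi / 4)}))"
proof (intro conjI allI impI)
  show eq: "{T. ghp_compatible T} = {Prime_D 1, C_prime 2, D_prime 2, D_prime 4}"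
  proof (intro equalityI subsetI)
    fix T assume "T \<in> {T. ghp_compatible T}"
    then show "T \<in> {Prime_D 1, C_prime 2, D_prime 2, D_prime 4}"
      using ghp_compatible_C_prime ghp_compatible_D_prime ghp_compatible_Prime_D
      by (cases T) auto
  next
    fix T assume "T \<in> {Prime_D 1, C_prime 2, D_prime 2, D_prime 4}"
    then show "T \<in> {T. ghp_compatible T}"
      using ghp_compatible_Prime_D_1 ghp_compatible_C_prime_2 ghp_compatible_D_prime_2
        ghp_compatible_D_prime_4 by blast
  qed
  show "card {T. ghp_compatible T} = 4" unfolding eq by simp
next
  fix G assume "has_type G (Prime_D 1)"
  then have "card (reflection_lines True G) = 1" by simp
  then show "\<exists>\<phi>. reflection_lines True G = {mirror_line \<phi>}"
    by (rule reflection_lines_card_1E) blast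
next
  fix G assume "has_type G (C_prime 2)"
  then show "flip_two_fold_centre G"
    by (simp add: flip_two_fold_centre_def alternating_rotations_2)
next
  fix G assume G: "has_type G (D_prime 2)"
  then show "flip_two_fold_centre G"
    by (simp add: flip_two_fold_centre_def alternating_rotations_2)
  show "\<exists>\<phi>. reflection_lines False G = {mirror_line \<phi>} \<and>
           reflection_lines True G = {mirror_line (\<phi> + pi / 2)}"
    using G by (rule D_prime_2_lines)
next
  fix G assume G: "has_type G (D_prime 4)"
  then show "flip_four_fold_centre G"
    by (simp add: flip_four_fold_centre_def alternating_rotations_4)
  show "\<exists>\<phi>. reflection_lines False G = {mirror_line \<phi>, mirror_line (\<phi> + pi / 2)} \<and>
           reflection_lines True G = {mirror_line (\<phi> + pi / 4), mirror_line (\<phi> + 3 * pi / 4)}"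
    using G by (rule D_prime_4_lines)
qed

end
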